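(* Let $A,B\in M_n(H)$ be $n\times n$ matrices ($n\geq 1$) over the commutative quaternions $H$. Then: (I) $\eta(I_n)=I_{2n}$; (II) $\eta(A+B)=\eta(A)+\eta(B)$; (III) $\eta(AB)=\eta(A)\eta(B)$; (IV) $\eta(A^{-1})=(\eta(A))^{-1}$ if $A^{-1}$ exists; (V) $\eta(A^{\dagger_1})=(\eta(A))^{\dagger}$, where $(\eta(A))^{\dagger}$ is the conjugate transpose of the complex matrix $\eta(A)$; but $\eta(A^{\dagger_2})\neq(\eta(A))^{\dagger}$ and $\eta(A^{\dagger_3})\neq(\eta(A))^{\dagger}$ in general (that is, neither of the identities $\eta(A^{\dagger_2})=(\eta(A))^\dagger$, $\eta(A^{\dagger_3})=(\eta(A))^\dagger$ holds for all $A\in M_n(H)$); (VI) $\det_q(AB)=\det_q(A)\det_q(B)$, and consequently $\det_q(A^{-1})=(\det_q(A))^{-1}$ if $A^{-1}$ exists.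
   Context: The commutative quaternions are the real algebra $H=\{q=t+ix+jy+kz : t,x,y,z\in\mathbb{R}\}$ with $\mathbb{R}$-basis $1,i,j,k$ and commutative bilinear multiplication determined by $i^2=k^2=-1$, $j^2=1$, $ijk=-1$, $ij=ji=k$, $jk=kj=i$, $ki=ik=-j$. The three principal conjugates of $q$ are $q^{(1)}=t-ix+jy-kz$, $q^{(2)}=t+ix-jy-kz$, $q^{(3)}=t-ix-jy+kz$. $M_n(H)$ is the set of $n\times n$ matrices with entries in $H$, with ordinary addition and multiplication. For $A=(a_{rs})\in M_n(H)$ and $l\in\{1,2,3\}$, $A^{(l)}=(a_{rs}^{(l)})$ and $A^{\dagger_l}=(A^{(l)})^T$. $A$ is invertible if $AB=BA=I_n$ for some $B\in M_n(H)$, and then $A^{-1}=B$. The elements $\alpha+i\beta$ ($\alpha,\beta\in\mathbb{R}$) of $H$ form a field identified with $\mathbb{C}$; every $q=t+ix+jy+kz\in H$ is uniquely $c_1+jc_2$ with $c_1=t+ix$, $c_2=y+iz\in\mathbb{C}$, so every $A\in M_n(H)$ is uniquely $A=A_1+jA_2$ with $A_1,A_2$ complex $n\times n$ matrices. The complex adjoint matrix of $A$ is the $2n\times2n$ complex matrix $\eta(A)=\begin{pmatrix} A_1 & A_2 \\ A_2 & A_1 \end{pmatrix}$, and the $q$-determinant of $A$ is $\det_q(A)=\det(\eta(A))$, the usual determinant of $\eta(A)$. *)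

theory Defs
  imports Complex_Main "Jordan_Normal_Form.Schur_Decomposition"
begin

text \<open>\<open>CQuat t x y z\<close> is the commutative quaternion \<open>t + ix + jy + kz\<close>.\<close>

datatype cquat = CQuat (cq_t: real) (cq_x: real) (cq_y: real) (cq_z: real)

lemma cquat_eq_iff:
  "p = q \<longleftrightarrow> cq_t p = cq_t q \<and> cq_x p = cq_x q \<and> cq_y p = cq_y q \<and> cq_z p = cq_z q"
  by (cases p; cases q) simp

instantiation cquat :: "{comm_ring_1, real_algebra_1}"
begin

definition zero_cquat :: cquat where
  "0 = CQuat 0 0 0 0"

definition one_cquat :: cquat where
  "1 = CQuat 1 0 0 0"

definition plus_cquat :: "cquat \<Rightarrow> cquat \<Rightarrow> cquat" where
  "p + q = CQuat (cq_t p + cq_t q) (cq_x p + cq_x q) (cq_y p + cq_y q) (cq_z p + cq_z q)"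

definition uminus_cquat :: "cquat \<Rightarrow> cquat" where
  "- p = CQuat (- cq_t p) (- cq_x p) (- cq_y p) (- cq_z p)"

definition minus_cquat :: "cquat \<Rightarrow> cquat \<Rightarrow> cquat" where
  "p - q = CQuat (cq_t p - cq_t q) (cq_x p - cq_x q) (cq_y p - cq_y q) (cq_z p - cq_z q)"

definition scaleR_cquat :: "real \<Rightarrow> cquat \<Rightarrow> cquat" where
  "scaleR r p = CQuat (r * cq_t p) (r * cq_x p) (r * cq_y p) (r * cq_z p)"

text \<open>The bilinear extension of the multiplication table of \<open>1, i, j, k\<close>; the table itself is
  checked in \<open>cq_multiplication_table\<close> below.\<close>

definition times_cquat :: "cquat \<Rightarrow> cquat \<Rightarrow> cquat" where
  "p * q = CQuat
     (cq_t p * cq_t q - cq_x p * cq_x q + cq_y p * cq_y q - cq_z p * cq_z q)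
     (cq_t p * cq_x q + cq_x p * cq_t q + cq_y p * cq_z q + cq_z p * cq_y q)
     (cq_t p * cq_y q + cq_y p * cq_t q - cq_x p * cq_z q - cq_z p * cq_x q)
     (cq_t p * cq_z q + cq_z p * cq_t q + cq_x p * cq_y q + cq_y p * cq_x q)"

instance
  by standard
    (simp_all add: cquat_eq_iff zero_cquat_def one_cquat_def plus_cquat_def uminus_cquat_def
      minus_cquat_def scaleR_cquat_def times_cquat_def algebra_simps)

end

lemmas cquat_defs = zero_cquat_def one_cquat_def plus_cquat_def uminus_cquat_def
  minus_cquat_def scaleR_cquat_def times_cquat_def

definition cq_i :: cquat where "cq_i = CQuat 0 1 0 0"
definition cq_j :: cquat where "cq_j = CQuat 0 0 1 0"
definition cq_k :: cquat where "cq_k = CQuat 0 0 0 1"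

lemma cq_multiplication_table:
  "cq_i * cq_i = - 1" "cq_k * cq_k = - 1" "cq_j * cq_j = 1" "cq_i * cq_j * cq_k = - 1"
  "cq_i * cq_j = cq_k" "cq_j * cq_i = cq_k"
  "cq_j * cq_k = cq_i" "cq_k * cq_j = cq_i"
  "cq_k * cq_i = - cq_j" "cq_i * cq_k = - cq_j"
  by (simp_all add: cq_i_def cq_j_def cq_k_def cquat_defs)

lemma CQuat_eq_basis:
  "CQuat t x y z = t *\<^sub>R 1 + x *\<^sub>R cq_i + y *\<^sub>R cq_j + z *\<^sub>R cq_k"
  by (simp add: cq_i_def cq_j_def cq_k_def cquat_defs)

definition cq_conj1 :: "cquat \<Rightarrow> cquat" where
  "cq_conj1 q = CQuat (cq_t q) (- cq_x q) (cq_y q) (- cq_z q)"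

definition cq_conj2 :: "cquat \<Rightarrow> cquat" where
  "cq_conj2 q = CQuat (cq_t q) (cq_x q) (- cq_y q) (- cq_z q)"

definition cq_conj3 :: "cquat \<Rightarrow> cquat" where
  "cq_conj3 q = CQuat (cq_t q) (- cq_x q) (- cq_y q) (cq_z q)"

definition dagger1 :: "cquat mat \<Rightarrow> cquat mat" where
  "dagger1 A = transpose_mat (map_mat cq_conj1 A)"

definition dagger2 :: "cquat mat \<Rightarrow> cquat mat" where
  "dagger2 A = transpose_mat (map_mat cq_conj2 A)"

definition dagger3 :: "cquat mat \<Rightarrow> cquat mat" where
  "dagger3 A = transpose_mat (map_mat cq_conj3 A)"

text \<open>The embedding identifying the complex numbers with the elements \<open>\<alpha> + i\<beta>\<close>, and the
  components of the decomposition \<open>q = c1 + j c2\<close>.\<close>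

definition cq_of_complex :: "complex \<Rightarrow> cquat" where
  "cq_of_complex c = CQuat (Re c) (Im c) 0 0"

definition cq_c1 :: "cquat \<Rightarrow> complex" where
  "cq_c1 q = Complex (cq_t q) (cq_x q)"

definition cq_c2 :: "cquat \<Rightarrow> complex" where
  "cq_c2 q = Complex (cq_y q) (cq_z q)"

lemma cq_of_complex_hom:
  "inj cq_of_complex" "cq_of_complex 1 = 1"
  "cq_of_complex (a + b) = cq_of_complex a + cq_of_complex b"
  "cq_of_complex (a * b) = cq_of_complex a * cq_of_complex b"
  by (simp_all add: inj_def cq_of_complex_def cquat_defs complex_eq_iff)

lemma cq_decomposition:
  "q = cq_of_complex a + cq_j * cq_of_complex b \<longleftrightarrow> a = cq_c1 q \<and> b = cq_c2 q"
  by (auto simp: cquat_eq_iff cq_of_complex_def cq_c1_def cq_c2_def cq_j_def cquat_defs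
      complex_eq_iff)

definition eta :: "cquat mat \<Rightarrow> complex mat" where
  "eta A = four_block_mat (map_mat cq_c1 A) (map_mat cq_c2 A) (map_mat cq_c2 A) (map_mat cq_c1 A)"

definition det_q :: "cquat mat \<Rightarrow> complex" where
  "det_q A = det (eta A)"

text \<open>The inverse of an invertible matrix; unspecified if there is none.\<close>

definition mat_inv :: "'a :: semiring_1 mat \<Rightarrow> 'a mat" where
  "mat_inv A = (THE B. inverts_mat A B \<and> inverts_mat B A)"

lemma mat_inv_eqI:
  assumes A: "A \<in> carrier_mat n n" and B: "B \<in> carrier_mat n n"
    and AB: "A * B = 1\<^sub>m n" and BA: "B * A = 1\<^sub>m n"
  shows "mat_inv A = B"
  unfolding mat_inv_def
proof (rule the_equality)
  show "inverts_mat A B \<and> inverts_mat B A"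
    using A B AB BA by (simp add: inverts_mat_def)
next
  fix C assume C: "inverts_mat A C \<and> inverts_mat C A"
  have AC: "A * C = 1\<^sub>m n" and CA: "C * A = 1\<^sub>m (dim_row C)"
    using C A by (auto simp: inverts_mat_def)
  have "C \<in> carrier_mat n n"
    using arg_cong[OF AC, of dim_col] arg_cong[OF CA, of dim_col] A by auto
  then show "C = B"
    using A B AC BA by (metis assoc_mult_mat left_mult_one_mat right_mult_one_mat)
qed

end

theory Submission
  imports Defs
begin

text \<open>Writing a commutative quaternion as \<open>q = c\<^sub>1 + j c\<^sub>2\<close>, the relation \<open>j\<^sup>2 = 1\<close> together with
  commutativity gives
  \<open>(a\<^sub>1 + j a\<^sub>2) (b\<^sub>1 + j b\<^sub>2) = (a\<^sub>1 b\<^sub>1 + a\<^sub>2 b\<^sub>2) + j (a\<^sub>1 b\<^sub>2 + a\<^sub>2 b\<^sub>1)\<close>,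
  which is precisely the rule for multiplying block matrices with rows \<open>(a\<^sub>1, a\<^sub>2)\<close> and
  \<open>(a\<^sub>2, a\<^sub>1)\<close>. No twist by complex conjugation occurs, because \<open>j\<close> commutes with \<open>i\<close>.
  Hence \<open>eta\<close> is a unital ring homomorphism (lemmas \<open>eta_one\<close>, \<open>eta_add\<close>, \<open>eta_mult\<close>), and the
  statements on inverses and on the \<open>q\<close>-determinant are formal consequences of that and of the
  multiplicativity of the complex determinant.

  The first principal conjugation conjugates both complex components; since the block pattern of
  \<open>eta\<close> is symmetric, transposing and conjugating \<open>eta A\<close> amounts to doing so in each block
  (\<open>eta_dagger1\<close>). The second conjugation fixes \<open>i\<close> and the third negates \<open>j\<close>, whereas
  \<open>eta (i I)\<close> is skew-Hermitian and \<open>eta (j I)\<close> is Hermitian. So the scalar matrices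
  \<open>i I\<close> and \<open>j I\<close> refute the corresponding identities in every positive dimension.\<close>

lemma eta_carrier [simp]:
  "A \<in> carrier_mat nr nc \<Longrightarrow> eta A \<in> carrier_mat (2 * nr) (2 * nc)"
  by (auto simp: eta_def)

lemma cq_c1_0 [simp]: "cq_c1 0 = 0"
  and cq_c2_0 [simp]: "cq_c2 0 = 0"
  and cq_c1_add: "cq_c1 (p + q) = cq_c1 p + cq_c1 q"
  and cq_c2_add: "cq_c2 (p + q) = cq_c2 p + cq_c2 q"
  and cq_c1_mult: "cq_c1 (p * q) = cq_c1 p * cq_c1 q + cq_c2 p * cq_c2 q"
  and cq_c2_mult: "cq_c2 (p * q) = cq_c1 p * cq_c2 q + cq_c2 p * cq_c1 q"
  by (simp_all add: cq_c1_def cq_c2_def cquat_defs complex_eq_iff)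

lemma cq_c1_1 [simp]: "cq_c1 1 = 1"
  and cq_c2_1 [simp]: "cq_c2 1 = 0"
  by (simp_all add: cq_c1_def cq_c2_def cquat_defs complex_eq_iff)

lemma cq_c1_sum: "cq_c1 (sum f S) = (\<Sum>s\<in>S. cq_c1 (f s))"
  by (induction S rule: infinite_finite_induct) (simp_all add: cq_c1_add)

lemma cq_c2_sum: "cq_c2 (sum f S) = (\<Sum>s\<in>S. cq_c2 (f s))"
  by (induction S rule: infinite_finite_induct) (simp_all add: cq_c2_add)

lemma map_cq_c1_mult:
  assumes "A \<in> carrier_mat nr n" and "B \<in> carrier_mat n nc"
  shows "map_mat cq_c1 (A * B)
    = map_mat cq_c1 A * map_mat cq_c1 B + map_mat cq_c2 A * map_mat cq_c2 B"
  using assms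
  by (intro eq_matI) (auto simp: scalar_prod_def cq_c1_sum cq_c1_mult sum.distrib)

lemma map_cq_c2_mult:
  assumes "A \<in> carrier_mat nr n" and "B \<in> carrier_mat n nc"
  shows "map_mat cq_c2 (A * B)
    = map_mat cq_c1 A * map_mat cq_c2 B + map_mat cq_c2 A * map_mat cq_c1 B"
  using assms
  by (intro eq_matI) (auto simp: scalar_prod_def cq_c2_sum cq_c2_mult sum.distrib)

lemma eta_one: "eta (1\<^sub>m n) = 1\<^sub>m (2 * n)"
  by (intro eq_matI) (auto simp: eta_def)

lemma eta_add:
  assumes "A \<in> carrier_mat nr nc" and "B \<in> carrier_mat nr nc"
  shows "eta (A + B) = eta A + eta B"
  using assms by (intro eq_matI) (auto simp: eta_def cq_c1_add cq_c2_add)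

text \<open>Multiplying the block matrices produces \<open>A\<^sub>1 B\<^sub>1 + A\<^sub>2 B\<^sub>2\<close> on the diagonal and
  \<open>A\<^sub>1 B\<^sub>2 + A\<^sub>2 B\<^sub>1\<close> off it, up to the order of summands in the lower row: these are the two complex
  components of \<open>A B\<close>.\<close>

lemma eta_mult:
  assumes A: "A \<in> carrier_mat nr n" and B: "B \<in> carrier_mat n nc"
  shows "eta (A * B) = eta A * eta B"
proof -
  have carr: "map_mat f A \<in> carrier_mat nr n" "map_mat f B \<in> carrier_mat n nc"
    for f :: "cquat \<Rightarrow> complex"
    using A B by auto
  have "eta A * eta B = four_block_mat
      (map_mat cq_c1 A * map_mat cq_c1 B + map_mat cq_c2 A * map_mat cq_c2 B)
      (map_mat cq_c1 A * map_mat cq_c2 B + map_mat cq_c2 A * map_mat cq_c1 B)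
      (map_mat cq_c2 A * map_mat cq_c1 B + map_mat cq_c1 A * map_mat cq_c2 B)
      (map_mat cq_c2 A * map_mat cq_c2 B + map_mat cq_c1 A * map_mat cq_c1 B)"
    unfolding eta_def by (rule mult_four_block_mat) (rule carr)+
  also have "\<dots> = eta (A * B)"
    unfolding eta_def map_cq_c1_mult[OF A B] map_cq_c2_mult[OF A B]
    by (intro arg_cong2[where f = "four_block_mat _ _"] refl
        comm_add_mat[where nr = nr and nc = nc])
      (use A B in auto)
  finally show ?thesis ..
qed

lemma invertible_matE:
  fixes A :: "'a :: semiring_1 mat"
  assumes "invertible_mat A" and "A \<in> carrier_mat n n"
  obtains B where "B \<in> carrier_mat n n" and "A * B = 1\<^sub>m n" and "B * A = 1\<^sub>m n"
    and "mat_inv A = B"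
proof -
  from assms obtain B where AB: "A * B = 1\<^sub>m n" and BA: "B * A = 1\<^sub>m (dim_row B)"
    by (auto simp: invertible_mat_def inverts_mat_def)
  have "B \<in> carrier_mat n n"
    using arg_cong[OF AB, of dim_col] arg_cong[OF BA, of dim_col] assms(2) by auto
  with AB BA assms(2) show thesis
    by (intro that[of B] mat_inv_eqI) auto
qed

lemma eta_mat_inv:
  assumes A: "A \<in> carrier_mat n n" and inv: "invertible_mat A"
  shows "invertible_mat (eta A)" and "eta (mat_inv A) = mat_inv (eta A)"
    and "eta A * eta (mat_inv A) = 1\<^sub>m (2 * n)"
proof -
  obtain B where B: "B \<in> carrier_mat n n" and AB: "A * B = 1\<^sub>m n" and BA: "B * A = 1\<^sub>m n"
    and inv_eq: "mat_inv A = B"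
    using invertible_matE[OF inv A] .
  have eAB: "eta A * eta B = 1\<^sub>m (2 * n)" and eBA: "eta B * eta A = 1\<^sub>m (2 * n)"
    using eta_mult[OF A B] eta_mult[OF B A] AB BA by (simp_all add: eta_one)
  note carr = eta_carrier[OF A] eta_carrier[OF B]
  show "invertible_mat (eta A)"
    using carr eAB eBA by (auto simp: invertible_mat_def inverts_mat_def)
  show "eta (mat_inv A) = mat_inv (eta A)"
    unfolding inv_eq by (rule mat_inv_eqI[OF carr eAB eBA, symmetric])
  show "eta A * eta (mat_inv A) = 1\<^sub>m (2 * n)"
    using eAB inv_eq by simp
qed

lemma mat_adjoint_index:
  fixes A :: "complex mat"
  assumes "i < dim_col A" and "j < dim_row A"
  shows "mat_adjoint A $$ (i, j) = cnj (A $$ (j, i))"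
  using assms by (simp add: mat_adjoint_def mat_of_rows_def)

lemma dim_mat_adjoint [simp]:
  "dim_row (mat_adjoint A) = dim_col A" "dim_col (mat_adjoint A) = dim_row A"
  by (simp_all add: mat_adjoint_def)

lemma eta_dagger1: "eta (dagger1 A) = mat_adjoint (eta A)"
proof -
  have "cq_c1 (cq_conj1 q) = cnj (cq_c1 q)" "cq_c2 (cq_conj1 q) = cnj (cq_c2 q)" for q
    by (simp_all add: cq_c1_def cq_c2_def cq_conj1_def complex_eq_iff)
  then show ?thesis
    by (intro eq_matI) (auto simp: eta_def dagger1_def mat_adjoint_index)
qed

text \<open>At \<open>C = i I\<close> the diagonal entries of the two sides are \<open>i\<close> and its complex
  conjugate \<open>-i\<close>.\<close>

lemma eta_dagger2_neq:
  assumes "n \<ge> 1"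
  shows "\<exists>C \<in> carrier_mat n n. eta (dagger2 C) \<noteq> mat_adjoint (eta C)"
proof
  let ?C = "cq_i \<cdot>\<^sub>m 1\<^sub>m n"
  show "?C \<in> carrier_mat n n"
    by simp
  have "eta (dagger2 ?C) $$ (0, 0) = \<i>" "mat_adjoint (eta ?C) $$ (0, 0) = - \<i>"
    using assms
    by (simp_all add: eta_def dagger2_def mat_adjoint_index cq_c1_def cq_conj2_def cq_i_def
        complex_eq_iff)
  moreover have "\<i> \<noteq> - \<i>"
    by (simp add: complex_eq_iff)
  ultimately show "eta (dagger2 ?C) \<noteq> mat_adjoint (eta ?C)"
    by metis
qed

text \<open>At \<open>C = j I\<close> both sides vanish on the diagonal blocks, so they are compared at the first
  entry of the upper right block, which lies in column \<open>n\<close>: it is \<open>-1\<close> on one side and \<open>1\<close> on the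
  other.\<close>

lemma eta_dagger3_neq:
  assumes "n \<ge> 1"
  shows "\<exists>C \<in> carrier_mat n n. eta (dagger3 C) \<noteq> mat_adjoint (eta C)"
proof
  let ?C = "cq_j \<cdot>\<^sub>m 1\<^sub>m n"
  show "?C \<in> carrier_mat n n"
    by simp
  have "eta (dagger3 ?C) $$ (0, n) = - 1" "mat_adjoint (eta ?C) $$ (0, n) = 1"
    using assms
    by (simp_all add: eta_def dagger3_def mat_adjoint_index cq_c2_def cq_conj3_def cq_j_def
        complex_eq_iff)
  then show "eta (dagger3 ?C) \<noteq> mat_adjoint (eta ?C)"
    by auto
qed

lemma det_q_mult:
  assumes "A \<in> carrier_mat n n" and "B \<in> carrier_mat n n"
  shows "det_q (A * B) = det_q A * det_q B"
  using assms unfolding det_q_def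
  by (simp add: eta_mult det_mult[of _ "2 * n"])

lemma det_q_mat_inv:
  assumes A: "A \<in> carrier_mat n n" and inv: "invertible_mat A"
  shows "det_q A \<noteq> 0" and "det_q (mat_inv A) = inverse (det_q A)"
proof -
  have "mat_inv A \<in> carrier_mat n n"
    using invertible_matE[OF inv A] by metis
  then have "det_q A * det_q (mat_inv A) = det (eta A * eta (mat_inv A))"
    using A by (simp add: det_q_def det_mult[of _ "2 * n"])
  also have "\<dots> = 1"
    using eta_mat_inv(3)[OF A inv] by simp
  finally have prod: "det_q A * det_q (mat_inv A) = 1" .
  then show "det_q A \<noteq> 0"
    by auto
  show "det_q (mat_inv A) = inverse (det_q A)"
    using inverse_unique[OF prod] ..
qed

theorem theorem5p3:
  fixes n :: nat and A B :: "cquat mat"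
  assumes "n \<ge> 1" and "A \<in> carrier_mat n n" and "B \<in> carrier_mat n n"
  shows "eta (1\<^sub>m n) = 1\<^sub>m (2 * n)
    \<and> eta (A + B) = eta A + eta B
    \<and> eta (A * B) = eta A * eta B
    \<and> (invertible_mat A \<longrightarrow> invertible_mat (eta A) \<and> eta (mat_inv A) = mat_inv (eta A))
    \<and> eta (dagger1 A) = mat_adjoint (eta A)
    \<and> \<not> (\<forall>C \<in> carrier_mat n n. eta (dagger2 C) = mat_adjoint (eta C))
    \<and> \<not> (\<forall>C \<in> carrier_mat n n. eta (dagger3 C) = mat_adjoint (eta C))
    \<and> det_q (A * B) = det_q A * det_q B
    \<and> (invertible_mat A \<longrightarrow> det_q A \<noteq> 0 \<and> det_q (mat_inv A) = inverse (det_q A))"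
  using eta_one eta_add[OF assms(2,3)] eta_mult[OF assms(2,3)] eta_mat_inv(1,2)[OF assms(2)]
    eta_dagger1 eta_dagger2_neq[OF assms(1)] eta_dagger3_neq[OF assms(1)]
    det_q_mult[OF assms(2,3)] det_q_mat_inv[OF assms(2)]
  by blast

end
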